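(* Let $t \leq n$ be non-negative integers. Say that a $t$-temperate family on $[n]$ is of maximal size if it has the maximum number of member sets among all $t$-temperate families on $[n]$. (a) If $t \equiv n \pmod{2}$, the only $t$-temperate family on $[n]$ of maximal size is $\bigcup_{j=0}^{t} \binom{[n]}{(n-t)/2 + j}$. (b) If $t=n-1$, any family on $[n]$ of size $2^n-1$ is a $t$-temperate family of maximal size. (c) If $t \not\equiv n \pmod 2$ and $t < n-1$, then there are exactly two $t$-temperate families on $[n]$ of maximal size: $\bigcup_{j=0}^{t} \binom{[n]}{(n-t-1)/2 + j}$ and $\bigcup_{j=0}^{t} \binom{[n]}{(n-t+1)/2 + j}$.
   Context: For a non-negative integer $n$, $[n]=\{1,\ldots,n\}$ (with $[0]=\emptyset$), $\mathcal{P}(X)$ denotes the power set of $X$, and $\binom{[n]}{k}$ denotes the set of subsets of $[n]$ of size $k$. A family on $[n]$ is a subset $\mathcal{F}\subseteq \mathcal{P}([n])$; its size is its number of member sets. For a family $\mathcal{F}\subseteq\mathcal{P}([n])$ and a set $A\in\mathcal{P}([n])$, let $\mu_{\mathcal{F}}(A)=|\mathcal{P}(A)\cap\mathcal{F}|$. For a non-negative integer $t$, $\mathcal{F}$ is called $t$-temperate if $\mu_{\mathcal{F}}(A)\leq\sum_{j=0}^t\binom{|A|}{j}$ for all $A\in\mathcal{F}$. *)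

theory Defs
  imports "HOL-Library.Ramsey" "HOL-Number_Theory.Cong"
begin

definition family_on :: "nat \<Rightarrow> nat set set \<Rightarrow> bool" where
  "family_on n F \<longleftrightarrow> F \<subseteq> Pow {1..n}"

definition mu :: "nat set set \<Rightarrow> nat set \<Rightarrow> nat" where
  "mu F A = card (Pow A \<inter> F)"

definition temperate :: "nat \<Rightarrow> nat set set \<Rightarrow> bool" where
  "temperate t F \<longleftrightarrow> (\<forall>A\<in>F. mu F A \<le> (\<Sum>j=0..t. card A choose j))"

definition maximal_temperate :: "nat \<Rightarrow> nat \<Rightarrow> nat set set \<Rightarrow> bool" where
  "maximal_temperate t n F \<longleftrightarrow>
     family_on n F \<and> temperate t F \<and>
     (\<forall>G. family_on n G \<and> temperate t G \<longrightarrow> card G \<le> card F)"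

(* nsets X k (from HOL-Library.Ramsey) is the set of the k-element subsets of X. *)
definition layers :: "nat \<Rightarrow> nat \<Rightarrow> nat \<Rightarrow> nat set set" where
  "layers n t s = (\<Union>j\<in>{0..t}. nsets {1..n} (s + j))"

end

theory Submission
  imports Defs Complex_Main
begin

text \<open>
  Take a uniformly random maximal chain in the power set of an \<open>n\<close>-set \<open>V\<close> and give every
  member \<open>B\<close> of the family \<open>F\<close> the weight \<open>n choose card B\<close>, the inverse of the probability
  that the chain passes through \<open>B\<close>. The expected total weight of the members on the chain is
  then \<open>card F\<close>. Now condition on the topmost member \<open>A\<close> of the chain. Below \<open>A\<close> the chain is
  uniform, so a member \<open>B\<close> below \<open>A\<close> contributes \<open>(n choose k) / (card A choose k)\<close>, where
  \<open>k = card B\<close>. This ratio increases with \<open>k\<close>, while temperateness bounds the number of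
  members below \<open>A\<close> by the number of sets in the top \<open>t + 1\<close> layers of \<open>Pow A\<close>. Hence the
  conditional expectation is at most the weight of these top layers, which is the sum of
  \<open>n choose k\<close> over the window of \<open>t + 1\<close> consecutive values of \<open>k\<close> ending at \<open>card A\<close>
  (\<open>shadow_weight_le_window\<close>). The window is largest when it is central
  (\<open>window_le_central\<close>), and central bands of layers attain this size.

  If \<open>F\<close> has maximum size, nothing is lost anywhere: every chain meets \<open>F\<close>, each possible
  topmost member has one of the central sizes, and, except for the full ground set with
  \<open>t < n\<close>, the members below it are exactly its top \<open>t + 1\<close> layers (\<open>topmost_member\<close>). If
  \<open>n + t = 2 * m\<close>, only the size \<open>m\<close> remains, so all \<open>m\<close>-sets are topmost members and \<open>F\<close> is
  the central band. If \<open>n + t = 2 * m + 1\<close> and \<open>t < n - 1\<close>, topmost members have size \<open>m\<close> or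
  \<open>m + 1\<close>; membership in layer \<open>m + 1\<close> propagates along single exchanges of elements
  (\<open>swap_closed\<close>), so this layer is either full or empty, which leaves two bands. For
  \<open>t = n - 1\<close> the upper bound is \<open>2 ^ n - 1\<close>, and any family of this size is temperate.
\<close>

section \<open>The largest member of a family on a random maximal chain\<close>

text \<open>For \<open>A \<subseteq> V\<close>, the value \<open>topmost_prob V F A\<close> is the probability that a uniformly random
  maximal chain, run from \<open>V\<close> down to \<open>{}\<close>, passes through \<open>A\<close> and meets \<open>F\<close> nowhere strictly above
  \<open>A\<close>. Such a chain reaches \<open>A\<close> from some \<open>insert x A\<close> outside \<open>F\<close>, by deleting one of the
  \<open>card A + 1\<close> elements of that set; this is the recursion, which starts
  from the value 1 at \<open>V\<close>, where every chain begins. Defining the probability through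
  it avoids the space of chains altogether.\<close>

function topmost_prob :: "'a set \<Rightarrow> 'a set set \<Rightarrow> 'a set \<Rightarrow> real" where
  "topmost_prob V F A =
     (if infinite V \<or> V \<subseteq> A then 1
      else (\<Sum>x\<in>V - A. if insert x A \<in> F then 0 else topmost_prob V F (insert x A))
             / (real (card A) + 1))"
  by pat_completeness auto
termination
proof (relation "measure (\<lambda>(V, F, A). card (V - A))")
  fix V A :: "'a set" and F :: "'a set set" and x :: 'a
  assume "\<not> (infinite V \<or> V \<subseteq> A)" "x \<in> V - A"
  then have "V - insert x A \<subset> V - A" "finite (V - A)" by auto
  then show "((V, F, insert x A), (V, F, A)) \<in> measure (\<lambda>(V, F, A). card (V - A))"
    by (simp add: psubset_card_mono)
qed simp

declare topmost_prob.simps [simp del]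

lemma topmost_prob_ground: "topmost_prob V F V = 1"
  by (simp add: topmost_prob.simps)

lemma topmost_prob_step:
  assumes "finite V" "A \<subset> V"
  shows "topmost_prob V F A =
    (\<Sum>x\<in>V - A. if insert x A \<in> F then 0 else topmost_prob V F (insert x A)) / (real (card A) + 1)"
  using assms by (subst topmost_prob.simps) auto

lemma topmost_prob_nonneg: "topmost_prob V F A \<ge> 0"
proof (induction V F A rule: topmost_prob.induct)
  case (1 V F A)
  show ?case
  proof (cases "infinite V \<or> V \<subseteq> A")
    case True
    then show ?thesis by (subst topmost_prob.simps) simp
  next
    case False
    then have "0 \<le> (\<Sum>x\<in>V - A. if insert x A \<in> F then 0 else topmost_prob V F (insert x A))"
      using "1.IH" by (intro sum_nonneg) simp
    then show ?thesis using False by (subst topmost_prob.simps) simp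
  qed
qed

lemma topmost_prob_pos_step:
  assumes "finite V" "A \<subseteq> V" "x \<in> V - A" "insert x A \<notin> F" "topmost_prob V F (insert x A) > 0"
  shows "topmost_prob V F A > 0"
proof -
  have "(\<Sum>x\<in>V - A. if insert x A \<in> F then 0 else topmost_prob V F (insert x A)) > 0"
    using assms by (intro sum_pos2[of _ x]) (auto simp: topmost_prob_nonneg)
  moreover have "A \<subset> V" using assms by auto
  ultimately show ?thesis using assms(1) by (simp add: topmost_prob_step divide_pos_pos)
qed

text \<open>This is the averaging step behind \<open>1 / (m choose k)\<close> being the probability that a random
  maximal chain below an \<open>m\<close>-set passes through a given \<open>k\<close>-subset: the chain arrives
  there from one of the \<open>m - k\<close> sets with one element more.\<close>

lemma inverse_choose_step:
  fixes m k :: nat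
  assumes "k < m"
  shows "real (m - k) * (1 / (real (m choose Suc k) * (real k + 1))) = 1 / real (m choose k)"
proof -
  have "Suc k * (m choose Suc k) = (m - k) * (m choose k)"
    by (rule trans[OF binomial_absorption binomial_absorb_comp[symmetric]])
  then have "real (Suc k * (m choose Suc k)) = real ((m - k) * (m choose k))"
    by (rule arg_cong)
  then have "(real k + 1) * real (m choose Suc k) = real (m - k) * real (m choose k)"
    by (simp only: of_nat_mult of_nat_Suc add.commute)
  then have "real (m - k) * (1 / (real (m choose Suc k) * (real k + 1)))
      = real (m - k) / (real (m - k) * real (m choose k))"
    by (simp only: mult.commute[of "real (m choose Suc k)"]) simp
  then show ?thesis using assms by simp
qed

text \<open>A random maximal chain passes through \<open>B\<close> with probability \<open>1 / (card V choose card B)\<close>. If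
  it does, either its topmost member \<open>A\<close> lies weakly above \<open>B\<close>, or \<open>F\<close> is met neither at
  \<open>B\<close> nor above it. Below its topmost member \<open>A\<close> the chain is still uniform, which gives
  the factors \<open>1 / (card A choose card B)\<close>. Formally, both sides satisfy the same recursion
  from the sets \<open>insert x B\<close> down to \<open>B\<close>.\<close>

lemma chain_through_set:
  assumes V: "finite V" and F: "F \<subseteq> Pow V" and B: "B \<subseteq> V"
  shows "(\<Sum>A | A \<in> F \<and> B \<subseteq> A. topmost_prob V F A / (card A choose card B))
      + (if B \<in> F then 0 else topmost_prob V F B) = 1 / (card V choose card B)"
  using B
proof (induction "card (V - B)" arbitrary: B)
  case 0
  then have "B = V" using V by auto
  moreover have "{A. A \<in> F \<and> V \<subseteq> A} = (if V \<in> F then {V} else {})" using F by auto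
  ultimately show ?case by (simp add: topmost_prob_ground)
next
  case (Suc d)
  let ?u = "topmost_prob V F" and ?k = "card B"
  let ?S = "\<lambda>C. \<Sum>A | A \<in> F \<and> C \<subseteq> A. ?u A / (card A choose card C)"
  have fF: "finite F" using V F by (meson finite_Pow_iff finite_subset)
  have fB: "finite B" using Suc.prems V finite_subset by blast
  have BV: "B \<subset> V" using Suc by auto
  have kn: "?k < card V" using BV V by (simp add: psubset_card_mono)
  \<comment> \<open>The term \<open>A = B\<close> of the sum and the correction term are exclusive and together give
    \<open>topmost_prob V F B\<close>, whether or not \<open>B\<close> is a member.\<close>
  have split: "?S B + (if B \<in> F then 0 else ?u B)
      = (\<Sum>A | A \<in> F \<and> B \<subset> A. ?u A / (card A choose ?k)) + ?u B"
  proof (cases "B \<in> F")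
    case True
    then have "{A. A \<in> F \<and> B \<subseteq> A} = insert B {A. A \<in> F \<and> B \<subset> A}" by auto
    then show ?thesis using True fF by simp
  next
    case False
    then have "{A. A \<in> F \<and> B \<subseteq> A} = {A. A \<in> F \<and> B \<subset> A}" by auto
    then show ?thesis using False by simp
  qed
  have "(\<Sum>A | A \<in> F \<and> B \<subset> A. ?u A / (card A choose ?k))
      = (\<Sum>A | A \<in> F \<and> B \<subset> A. \<Sum>x\<in>A - B. ?u A / ((card A choose Suc ?k) * (real ?k + 1)))"
  proof (rule sum.cong[OF refl])
    fix A assume A: "A \<in> {A. A \<in> F \<and> B \<subset> A}"
    then have "finite A" using F V finite_subset by blast
    then have "?k < card A" "card (A - B) = card A - ?k"
      using A fB by (auto simp: psubset_card_mono card_Diff_subset)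
    then show "?u A / (card A choose ?k)
        = (\<Sum>x\<in>A - B. ?u A / ((card A choose Suc ?k) * (real ?k + 1)))"
      using arg_cong[OF inverse_choose_step[of ?k "card A"], of "\<lambda>y. ?u A * y"]
      by (simp add: mult.commute)
  qed
  also have "\<dots> = (\<Sum>A | A \<in> F \<and> B \<subset> A. \<Sum>x | x \<in> V - B \<and> x \<in> A.
      ?u A / ((card A choose Suc ?k) * (real ?k + 1)))"
    using F by (intro sum.cong) auto
  also have "\<dots> = (\<Sum>x\<in>V - B. \<Sum>A | A \<in> {A. A \<in> F \<and> B \<subset> A} \<and> x \<in> A.
      ?u A / ((card A choose Suc ?k) * (real ?k + 1)))"
    using fF V by (intro sum.swap_restrict) auto
  also have "\<dots> = (\<Sum>x\<in>V - B. ?S (insert x B) / (real ?k + 1))"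
  proof (rule sum.cong[OF refl])
    fix x assume x: "x \<in> V - B"
    have "{A \<in> {A. A \<in> F \<and> B \<subset> A}. x \<in> A} = {A. A \<in> F \<and> insert x B \<subseteq> A}"
      using x by auto
    then show "(\<Sum>A | A \<in> {A. A \<in> F \<and> B \<subset> A} \<and> x \<in> A. ?u A / ((card A choose Suc ?k) * (real ?k + 1)))
      = ?S (insert x B) / (real ?k + 1)"
      using x fB by (simp add: sum_divide_distrib)
  qed
  finally have above: "(\<Sum>A | A \<in> F \<and> B \<subset> A. ?u A / (card A choose ?k))
      = (\<Sum>x\<in>V - B. ?S (insert x B) / (real ?k + 1))" .
  note split
  also have "(\<Sum>A | A \<in> F \<and> B \<subset> A. ?u A / (card A choose ?k)) + ?u B
      = (\<Sum>x\<in>V - B. ?S (insert x B) / (real ?k + 1))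
        + (\<Sum>x\<in>V - B. (if insert x B \<in> F then 0 else ?u (insert x B)) / (real ?k + 1))"
    by (simp only: above topmost_prob_step[OF V BV] sum_divide_distrib[of _ "V - B"])
  also have "\<dots> = (\<Sum>x\<in>V - B. (?S (insert x B) + (if insert x B \<in> F then 0 else ?u (insert x B)))
           / (real ?k + 1))"
    by (simp only: add_divide_distrib sum.distrib)
  also have "\<dots> = (\<Sum>x\<in>V - B. 1 / (card V choose Suc ?k) / (real ?k + 1))"
  proof (rule sum.cong[OF refl])
    fix x assume x: "x \<in> V - B"
    have "V - insert x B = (V - B) - {x}" by auto
    then have "d = card (V - insert x B)" using Suc.hyps(2) x V by simp
    then show "(?S (insert x B) + (if insert x B \<in> F then 0 else ?u (insert x B))) / (real ?k + 1)
       = 1 / (card V choose Suc ?k) / (real ?k + 1)"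
      using Suc.hyps(1)[of "insert x B"] x BV fB by simp
  qed
  also have "\<dots> = 1 / (card V choose ?k)"
    using inverse_choose_step[OF kn] BV V fB by (simp add: card_Diff_subset)
  finally show ?case .
qed

lemma sum_topmost_prob:
  assumes "finite V" "F \<subseteq> Pow V"
  shows "(\<Sum>A\<in>F. topmost_prob V F A) + (if {} \<in> F then 0 else topmost_prob V F {}) = 1"
  using chain_through_set[OF assms, of "{}"] by simp

text \<open>If every set \<open>B \<in> F\<close> is given weight \<open>n choose card B\<close>, the inverse of its probability of
  lying on a random maximal chain of an \<open>n\<close>-set, then this is the expected weight that a
  chain collects given that its topmost member is \<open>A\<close>.\<close>

definition shadow_weight :: "nat \<Rightarrow> 'a set set \<Rightarrow> 'a set \<Rightarrow> real" where
  "shadow_weight n F A = (\<Sum>B\<in>Pow A \<inter> F. real (n choose card B) / real (card A choose card B))"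

text \<open>With these weights each member contributes exactly 1 to the expected weight of a random
  maximal chain. Conditioning on the topmost member of the chain yields the right-hand side.\<close>

lemma card_eq_sum_shadow_weight:
  assumes V: "finite V" and F: "F \<subseteq> Pow V"
  shows "real (card F) = (\<Sum>A\<in>F. topmost_prob V F A * shadow_weight (card V) F A)"
proof -
  let ?u = "topmost_prob V F"
  have fF: "finite F" using V F by (meson finite_Pow_iff finite_subset)
  have "real (card F) = (\<Sum>B\<in>F. real (card V choose card B) *
      (\<Sum>A | A \<in> F \<and> B \<subseteq> A. ?u A / (card A choose card B)))"
  proof -
    have "1 = real (card V choose card B) * (\<Sum>A | A \<in> F \<and> B \<subseteq> A. ?u A / (card A choose card B))"
      if "B \<in> F" for B
    proof -
      have "B \<subseteq> V" using that F by auto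
      moreover have "card V choose card B > 0" using \<open>B \<subseteq> V\<close> V by (simp add: card_mono)
      ultimately show ?thesis using chain_through_set[OF V F, of B] that by simp
    qed
    then show ?thesis by simp
  qed
  also have "\<dots> = (\<Sum>B\<in>F. \<Sum>A | A \<in> F \<and> B \<subseteq> A.
      ?u A * (real (card V choose card B) / real (card A choose card B)))"
    by (simp add: sum_distrib_left mult_ac)
  also have "\<dots> = (\<Sum>A\<in>F. \<Sum>B | B \<in> F \<and> B \<subseteq> A.
      ?u A * (real (card V choose card B) / real (card A choose card B)))"
    using fF by (intro sum.swap_restrict) auto
  also have "\<dots> = (\<Sum>A\<in>F. ?u A * shadow_weight (card V) F A)"
  proof -
    have "{B. B \<in> F \<and> B \<subseteq> A} = Pow A \<inter> F" for A by auto
    then show ?thesis by (simp add: shadow_weight_def sum_distrib_left)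
  qed
  finally show ?thesis .
qed

text \<open>When every chain meets \<open>F\<close>, a chain that has come down to a non-member \<open>A\<close> without meeting
  \<open>F\<close> must meet it further down.\<close>

lemma topmost_member_below:
  assumes V: "finite V" and F: "F \<subseteq> Pow V" and full: "(\<Sum>A\<in>F. topmost_prob V F A) = 1"
    and A: "A \<subseteq> V" "A \<notin> F" "topmost_prob V F A > 0"
  shows "\<exists>B\<in>F. B \<subset> A \<and> topmost_prob V F B > 0"
  using A
proof (induction "card A" arbitrary: A)
  case 0
  then have "A = {}" using V finite_subset by fastforce
  then show ?case using 0 full sum_topmost_prob[OF V F] by simp
next
  case (Suc d)
  then obtain x where x: "x \<in> A" by fastforce
  let ?B = "A - {x}"
  have ins: "insert x ?B = A" using x by auto
  have pos: "topmost_prob V F ?B > 0"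
    using Suc.prems x ins V by (intro topmost_prob_pos_step[of V ?B x]) auto
  show ?case
  proof (cases "?B \<in> F")
    case True
    then show ?thesis using pos x by blast
  next
    case False
    have "d = card ?B" using Suc.hyps(2) x by simp
    then have "\<exists>C\<in>F. C \<subset> ?B \<and> topmost_prob V F C > 0"
      using Suc.hyps(1)[of ?B] Suc.prems False pos by auto
    then show ?thesis by blast
  qed
qed

section \<open>Binomial windows\<close>

text \<open>The number of subsets of an \<open>n\<close>-set in the \<open>t + 1\<close> consecutive layers that end at layer
  \<open>m\<close>. For \<open>m < t\<close> the truncated subtraction cuts the range off at layer 0.\<close>

definition window :: "nat \<Rightarrow> nat \<Rightarrow> nat \<Rightarrow> nat" where
  "window n t m = (\<Sum>k=m-t..m. n choose k)"

text \<open>Binomial coefficients increase up to the middle; if \<open>b\<close> lies beyond it, its mirror image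
  \<open>n - b\<close> still exceeds \<open>a\<close>.\<close>

lemma choose_less_choose:
  fixes a b n :: nat
  assumes "a < b" "a + b < n"
  shows "n choose a < n choose b"
proof (cases "2 * b \<le> n")
  case True
  then show ?thesis using assms by (intro binomial_strict_mono) auto
next
  case False
  have "n choose a < n choose (n - b)" using assms False by (intro binomial_strict_mono) auto
  then show ?thesis using assms binomial_symmetric[of b n] by simp
qed

text \<open>Shifting the window up by one gains layer \<open>m + 1\<close> and loses layer \<open>m - t\<close>. Comparing these
  two binomial coefficients shows that \<open>window n t\<close> increases while \<open>2 * m + 1 < n + t\<close>,
  decreases when \<open>2 * m + 1 > n + t\<close>, and is constant across the step where equality holds.\<close>

lemma window_Suc:
  assumes "m < n"
  shows "window n t (Suc m) + (if t \<le> m then n choose (m - t) else 0)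
       = window n t m + (n choose Suc m)"
proof (cases "t \<le> m")
  case True
  then have "{m - t..m} = insert (m - t) {Suc (m - t)..m}" by auto
  moreover have "{Suc m - t..Suc m} = insert (Suc m) {Suc (m - t)..m}" using True by auto
  ultimately show ?thesis using True by (simp add: window_def)
next
  case False
  then show ?thesis by (simp add: window_def)
qed

lemma window_increasing:
  assumes "t \<le> n" "2 * m + 1 < n + t"
  shows "window n t m < window n t (Suc m)"
proof -
  have "m < n" using assms by auto
  note w = window_Suc[OF this, of t]
  show ?thesis
  proof (cases "t \<le> m")
    case True
    have "n choose (m - t) < n choose (Suc m)"
      using True assms by (intro choose_less_choose) auto
    then show ?thesis using w True by simp
  next
    case False
    have "n choose Suc m > 0" using \<open>m < n\<close> by simp
    then show ?thesis using w False by simp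
  qed
qed

lemma window_decreasing:
  assumes "t \<le> n" "n + t < 2 * m + 1" "m < n"
  shows "window n t (Suc m) < window n t m"
proof -
  have tm: "t \<le> m" using assms by auto
  have "n choose (n - Suc m) < n choose (n - (m - t))"
    using tm assms by (intro choose_less_choose) auto
  then have "n choose Suc m < n choose (m - t)"
    using assms binomial_symmetric[of "Suc m" n] binomial_symmetric[of "m - t" n] by simp
  then show ?thesis using window_Suc[OF assms(3), of t] tm by simp
qed

lemma window_equal:
  assumes "t \<le> n" "2 * m + 1 = n + t" "m < n"
  shows "window n t (Suc m) = window n t m"
proof -
  have tm: "t \<le> m" using assms by auto
  have "n - Suc m = m - t" using assms by auto
  then have "n choose Suc m = n choose (m - t)"
    using assms binomial_symmetric[of "Suc m" n] by simp
  then show ?thesis using window_Suc[OF assms(3), of t] tm by simp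
qed

lemma window_below:
  assumes "t \<le> n" "m < p" "2 * p \<le> n + t"
  shows "window n t m < window n t p"
  using assms(2)
proof (induction rule: strict_inc_induct)
  case (base i)
  then show ?case using window_increasing[of t n i] assms by simp
next
  case (step i)
  then show ?case using window_increasing[of t n i] assms by simp
qed

lemma window_above:
  assumes "t \<le> n" "p < m" "n + t \<le> 2 * p" "m \<le> n"
  shows "window n t m < window n t p"
  using assms(2,4)
proof (induction m)
  case (Suc m)
  have "window n t (Suc m) < window n t m" using Suc assms by (intro window_decreasing) auto
  then show ?case using Suc by (cases "m = p") auto
qed simp

text \<open>The window is largest exactly when it is as central as parity allows: there is one maximiser
  \<open>m\<close> if \<open>n + t\<close> is even, and there are two if \<open>n + t\<close> is odd.\<close>

lemma window_le_central:
  assumes "t \<le> n" "m \<le> n"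
  shows "window n t m \<le> window n t ((n + t) div 2)"
    and "window n t m = window n t ((n + t) div 2) \<longleftrightarrow>
      2 * m = n + t \<or> 2 * m + 1 = n + t \<or> 2 * m = n + t + 1"
proof -
  define c where "c = (n + t) div 2"
  define d where "d = (n + t + 1) div 2"
  have cd: "2 * c = n + t \<and> d = c \<or> 2 * c + 1 = n + t \<and> d = Suc c"
    unfolding c_def d_def by presburger
  then have "m < c \<or> m = c \<or> m = d \<or> m > d" by auto
  moreover have "window n t d = window n t c" if "d \<le> n"
    using cd window_equal[of t n c] assms that by auto
  moreover have "window n t m < window n t c" if "m < c"
    using that assms cd by (intro window_below) auto
  moreover have "window n t m < window n t d" if "m > d"
    using that assms cd by (intro window_above) auto
  ultimately have "window n t m < window n t c \<and> (m < c \<or> m > d) \<or>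
      window n t m = window n t c \<and> (m = c \<or> m = d)"
    using assms by fastforce
  moreover have "(m < c \<or> m > d) \<longleftrightarrow> \<not> (2 * m = n + t \<or> 2 * m + 1 = n + t \<or> 2 * m = n + t + 1)"
    using cd by auto
  moreover have "(m = c \<or> m = d) \<longleftrightarrow> (2 * m = n + t \<or> 2 * m + 1 = n + t \<or> 2 * m = n + t + 1)"
    using cd by auto
  ultimately show "window n t m \<le> window n t ((n + t) div 2)"
    "window n t m = window n t ((n + t) div 2) \<longleftrightarrow>
      2 * m = n + t \<or> 2 * m + 1 = n + t \<or> 2 * m = n + t + 1"
    unfolding c_def[symmetric] by auto
qed

section \<open>Weighing a member by the members below it\<close>

text \<open>The quotient of consecutive ratios is \<open>(n - k) / (m - k)\<close>, which is at least 1, and is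
  larger than 1 if \<open>m < n\<close>.\<close>

lemma choose_ratio_mono:
  fixes j k m n :: nat
  assumes "j \<le> k" "k \<le> m" "m \<le> n"
  shows "real (n choose j) / real (m choose j) \<le> real (n choose k) / real (m choose k)"
    and "j < k \<Longrightarrow> m < n \<Longrightarrow>
      real (n choose j) / real (m choose j) < real (n choose k) / real (m choose k)"
proof -
  let ?r = "\<lambda>k. real (n choose k) / real (m choose k)"
  have step: "?r (Suc i) = ?r i * (real (n - i) / real (m - i))" if "i < m" for i
  proof -
    have "real (p choose Suc i) = real (p - i) * real (p choose i) / real (Suc i)" for p
    proof -
      have "real (Suc i) * real (p choose Suc i) = real (p - i) * real (p choose i)"
        unfolding of_nat_mult[symmetric] binomial_absorption binomial_absorb_comp ..
      then show ?thesis by (simp add: field_simps del: of_nat_Suc)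
    qed
    then show ?thesis by (simp add: mult.commute del: of_nat_Suc)
  qed
  have pos: "?r i > 0" if "i \<le> m" for i using that assms by simp
  have le: "?r i \<le> ?r (Suc i)" if "i < m" for i
  proof -
    have "?r i * 1 \<le> ?r i * (real (n - i) / real (m - i))"
      using that assms pos[of i] by (intro mult_left_mono) auto
    then show ?thesis unfolding step[OF that] by simp
  qed
  have less: "?r i < ?r (Suc i)" if "i < m" "m < n" for i
  proof -
    have "?r i * 1 < ?r i * (real (n - i) / real (m - i))"
      using that pos[of i] by (intro mult_strict_left_mono) auto
    then show ?thesis unfolding step[OF that(1)] by simp
  qed
  show "?r j \<le> ?r k" using assms(1,2)
  proof (induction k rule: dec_induct)
    case (step i)
    then show ?case using le[of i] by simp
  qed simp
  show "?r j < ?r k" if "j < k" "m < n" using \<open>j < k\<close> assms(2)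
  proof (induction j rule: strict_inc_induct)
    case (base i) then show ?case using less[of i] that by simp
  next
    case (step i) then show ?case using less[of i] that by simp
  qed
qed

text \<open>The exchange argument of the knapsack problem: if \<open>Q\<close> consists of items of weight at least
  \<open>c\<close> and everything outside weighs at most \<open>c\<close>, no set with at most as many items as \<open>Q\<close> is
  heavier. In the case of equality, strictness outside \<open>Q\<close> rules out any replacement, and
  positivity of \<open>c\<close> rules out any omission.\<close>

lemma sum_le_of_threshold:
  fixes w :: "'b \<Rightarrow> real"
  assumes fin: "finite P" "finite Q" and card: "card P \<le> card Q" and c: "c > 0"
    and out: "\<And>x. x \<in> P - Q \<Longrightarrow> w x \<le> c" and inn: "\<And>x. x \<in> Q \<Longrightarrow> c \<le> w x"
  shows "sum w P \<le> sum w Q"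
    and "(\<And>x. x \<in> P - Q \<Longrightarrow> w x < c) \<Longrightarrow> sum w P = sum w Q \<Longrightarrow> P = Q"
proof -
  have P: "sum w P = sum w (P \<inter> Q) + sum w (P - Q)" "card P = card (P \<inter> Q) + card (P - Q)"
    using fin by (auto simp: sum.Int_Diff card_Int_Diff)
  have Q: "sum w Q = sum w (P \<inter> Q) + sum w (Q - P)" "card Q = card (P \<inter> Q) + card (Q - P)"
    using fin by (auto simp: sum.Int_Diff[of Q w P] card_Int_Diff[of Q P] Int_commute)
  have 1: "sum w (P - Q) \<le> card (P - Q) * c" using out sum_bounded_above[of "P - Q" w c] by simp
  have 2: "card (P - Q) * c \<le> card (Q - P) * c" using card P Q c by simp
  have 3: "card (Q - P) * c \<le> sum w (Q - P)" using inn sum_bounded_below[of "Q - P" c w] by simp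
  show "sum w P \<le> sum w Q" using 1 2 3 P Q by linarith
  assume strict: "\<And>x. x \<in> P - Q \<Longrightarrow> w x < c" and eq: "sum w P = sum w Q"
  have "P - Q = {}"
  proof (rule ccontr)
    assume "P - Q \<noteq> {}"
    then have "sum w (P - Q) < (\<Sum>x\<in>P - Q. c)" using strict fin by (intro sum_strict_mono) auto
    then show False using 2 3 P Q eq by simp
  qed
  then have "sum w (P - Q) = 0" by (simp only: sum.empty)
  then have "card (Q - P) * c \<le> 0" using 3 P Q eq by linarith
  then have "card (Q - P) = 0" using c by (simp add: mult_le_0_iff)
  then have "Q - P = {}" using fin by simp
  then show "P = Q" using \<open>P - Q = {}\<close> by auto
qed

definition top_layers :: "nat \<Rightarrow> 'a set \<Rightarrow> 'a set set" where
  "top_layers t A = {B. B \<subseteq> A \<and> card A - t \<le> card B}"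

lemma finite_top_layers: "finite A \<Longrightarrow> finite (top_layers t A)"
  unfolding top_layers_def by (rule finite_subset[of _ "Pow A"]) auto

lemma sum_over_subsets_by_card:
  fixes g :: "nat \<Rightarrow> 'b::semiring_1"
  assumes "finite A" "b \<le> card A"
  shows "(\<Sum>B | B \<subseteq> A \<and> a \<le> card B \<and> card B \<le> b. g (card B)) = (\<Sum>k=a..b. of_nat (card A choose k) * g k)"
proof -
  let ?S = "{B. B \<subseteq> A \<and> a \<le> card B \<and> card B \<le> b}"
  have "finite ?S" using assms by (auto intro: finite_subset[of _ "Pow A"])
  then have "(\<Sum>B\<in>?S. g (card B)) = (\<Sum>k=a..b. \<Sum>B | B \<in> ?S \<and> card B = k. g (card B))"
    by (intro sum.group[symmetric]) auto
  also have "\<dots> = (\<Sum>k=a..b. of_nat (card A choose k) * g k)"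
  proof (rule sum.cong[OF refl])
    fix k assume "k \<in> {a..b}"
    then have "{B. B \<in> ?S \<and> card B = k} = {B. B \<subseteq> A \<and> card B = k}" by auto
    moreover have "(\<Sum>B | B \<subseteq> A \<and> card B = k. g (card B)) = (\<Sum>B | B \<subseteq> A \<and> card B = k. g k)"
      by (rule sum.cong) auto
    ultimately show "(\<Sum>B | B \<in> ?S \<and> card B = k. g (card B)) = of_nat (card A choose k) * g k"
      using n_subsets[OF assms(1), of k] by simp
  qed
  finally show ?thesis .
qed

lemma top_layers_card_le:
  "finite A \<Longrightarrow> top_layers t A = {B. B \<subseteq> A \<and> card A - t \<le> card B \<and> card B \<le> card A}"
  by (auto simp: top_layers_def card_mono)

lemma card_top_layers:
  assumes "finite A"
  shows "card (top_layers t A) = (\<Sum>j=0..t. card A choose j)"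
proof -
  let ?m = "card A"
  have "card (top_layers t A) = (\<Sum>k=?m-t..?m. ?m choose k)"
    using sum_over_subsets_by_card[OF assms, where b = ?m and a = "?m - t" and g = "\<lambda>_. 1::nat"] assms
    by (simp add: top_layers_card_le)
  also have "\<dots> = (\<Sum>j=0..min t ?m. ?m choose j)"
    by (rule sum.reindex_bij_witness[of _ "\<lambda>k. ?m - k" "\<lambda>k. ?m - k"])
      (auto simp: binomial_symmetric[symmetric])
  also have "\<dots> = (\<Sum>j=0..t. ?m choose j)"
    by (rule sum.mono_neutral_left) auto
  finally show ?thesis .
qed

lemma sum_top_layers:
  assumes "finite A"
  shows "(\<Sum>B\<in>top_layers t A. real (n choose card B) / real (card A choose card B))
       = real (window n t (card A))"
  using sum_over_subsets_by_card[OF assms, where b = "card A" and a = "card A - t"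
      and g = "\<lambda>k. real (n choose k) / real (card A choose k)"] assms
  by (simp add: top_layers_card_le window_def)

text \<open>The key estimate. The weight \<open>(n choose k) / (card A choose k)\<close> increases with \<open>k\<close>, and \<open>A\<close>
  has exactly as many subsets in its top \<open>t + 1\<close> layers as the temperateness condition
  allows below \<open>A\<close>. So the heaviest admissible choice takes precisely these layers, and
  their total weight is a window. Uniqueness needs either strictly increasing weights
  (\<open>card A < n\<close>) or that the top layers exhaust \<open>Pow A\<close> (\<open>card A \<le> t\<close>).\<close>

lemma shadow_weight_le_window:
  assumes A: "finite A" "card A \<le> n" and temp: "card (Pow A \<inter> F) \<le> (\<Sum>j=0..t. card A choose j)"
  shows "shadow_weight n F A \<le> window n t (card A)"
    and "card A < n \<or> card A \<le> t \<Longrightarrow> shadow_weight n F A = window n t (card A) \<Longrightarrow> Pow A \<inter> F = top_layers t A"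
proof -
  let ?m = "card A"
  let ?w = "\<lambda>B. real (n choose card B) / real (?m choose card B)"
  \<comment> \<open>The threshold is the weight of the lowest of the top layers.\<close>
  define c where "c = real (n choose (?m - t)) / real (?m choose (?m - t))"
  have c: "c > 0" using A by (simp add: c_def)
  have fin: "finite (Pow A \<inter> F)" "finite (top_layers t A)" using A by (auto simp: finite_top_layers)
  have card: "card (Pow A \<inter> F) \<le> card (top_layers t A)" using temp A by (simp add: card_top_layers)
  have inn: "c \<le> ?w B" if "B \<in> top_layers t A" for B
    unfolding c_def using that A by (intro choose_ratio_mono) (auto simp: top_layers_def card_mono)
  have out: "?w B \<le> c" "?m < n \<or> ?m \<le> t \<Longrightarrow> ?w B < c" if "B \<in> Pow A \<inter> F - top_layers t A" for B
    unfolding c_def using that A by (auto intro!: choose_ratio_mono simp: top_layers_def)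
  note thr = sum_le_of_threshold[where w = ?w, OF fin card c out(1) inn]
  show "shadow_weight n F A \<le> window n t ?m"
    using thr(1) A by (simp add: shadow_weight_def sum_top_layers)
  show "Pow A \<inter> F = top_layers t A" if "?m < n \<or> ?m \<le> t" "shadow_weight n F A = window n t ?m"
    using thr(2) out(2) that A by (simp add: shadow_weight_def sum_top_layers)
qed

section \<open>The maximum size of a temperate family\<close>

locale temperate_family =
  fixes V :: "'a set" and F :: "'a set set" and t :: nat
  assumes fin: "finite V" and sub: "F \<subseteq> Pow V" and t_le: "t \<le> card V"
    and temp: "A \<in> F \<Longrightarrow> card (Pow A \<inter> F) \<le> (\<Sum>j=0..t. card A choose j)"
begin

abbreviation u :: "'a set \<Rightarrow> real" where
  "u \<equiv> topmost_prob V F"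

abbreviation max_size :: nat where
  "max_size \<equiv> window (card V) t ((card V + t) div 2)"

lemma fin_F: "finite F"
  using fin sub by (meson finite_Pow_iff finite_subset)

lemma member:
  assumes "A \<in> F"
  shows "A \<subseteq> V" "finite A" "card A \<le> card V"
  using assms sub fin by (auto intro: finite_subset card_mono)

lemma shadow_weight_le_max_size:
  assumes "A \<in> F"
  shows "shadow_weight (card V) F A \<le> max_size"
  using shadow_weight_le_window(1)[OF member(2,3)[OF assms] temp[OF assms]]
    window_le_central(1)[OF t_le member(3)[OF assms]] by linarith

lemma sum_u_le_1: "(\<Sum>A\<in>F. u A) \<le> 1"
  using sum_topmost_prob[OF fin sub] topmost_prob_nonneg[of V F "{}"] by (auto split: if_splits)

text \<open>The gap between \<open>max_size\<close> and \<open>card F\<close> splits into nonnegative losses: what each possible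
  topmost member falls short of \<open>max_size\<close>, and the probability that a chain misses \<open>F\<close>.
  This gives the upper bound, and shows that all losses vanish in an extremal family.\<close>

lemma weighted_deficit:
  "(\<Sum>A\<in>F. u A * (max_size - shadow_weight (card V) F A)) + max_size * (1 - (\<Sum>A\<in>F. u A))
   = real max_size - real (card F)"
  unfolding card_eq_sum_shadow_weight[OF fin sub]
  by (simp add: algebra_simps sum_subtractf sum_distrib_right sum_distrib_left)

lemma deficit_nonneg:
  "A \<in> F \<Longrightarrow> 0 \<le> u A * (max_size - shadow_weight (card V) F A)"
  "0 \<le> max_size * (1 - (\<Sum>A\<in>F. u A))"
  using shadow_weight_le_max_size sum_u_le_1 by (simp_all add: topmost_prob_nonneg)

lemma card_le_max_size: "card F \<le> max_size"
  using weighted_deficit deficit_nonneg(2)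
    sum_nonneg[of F "\<lambda>A. u A * (max_size - shadow_weight (card V) F A)"] deficit_nonneg(1)
  by fastforce

lemma u_pos_if_no_member_above:
  assumes "A \<subseteq> V" "\<And>C. C \<in> F \<Longrightarrow> \<not> A \<subset> C"
  shows "u A > 0"
  using assms
proof (induction "card (V - A)" arbitrary: A)
  case 0
  then have "A = V" using fin by auto
  then show ?case by (simp add: topmost_prob_ground)
next
  case (Suc d)
  then have "V - A \<noteq> {}" by (intro notI) simp
  then obtain x where x: "x \<in> V - A" by blast
  have "V - insert x A = (V - A) - {x}" by auto
  then have d: "d = card (V - insert x A)" using Suc.hyps(2) x fin by simp
  have "u (insert x A) > 0" using x Suc.prems by (intro Suc.hyps(1)[OF d]) blast+
  moreover have "insert x A \<notin> F" using x Suc.prems(2)[of "insert x A"] by auto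
  ultimately show ?case using topmost_prob_pos_step[OF fin Suc.prems(1) x] by blast
qed

end

section \<open>The structure of extremal families\<close>

definition band :: "'a set \<Rightarrow> nat \<Rightarrow> nat \<Rightarrow> 'a set set" where
  "band V a b = {B. B \<subseteq> V \<and> a \<le> card B \<and> card B \<le> b}"

locale extremal_temperate_family = temperate_family +
  assumes size: "card F = max_size"
begin

lemma max_size_pos: "max_size > 0"
proof -
  have "card V choose ((card V + t) div 2) \<le> max_size"
    unfolding window_def by (rule member_le_sum) auto
  moreover have "card V choose ((card V + t) div 2) > 0" using t_le by simp
  ultimately show ?thesis by linarith
qed

lemma sum_u: "(\<Sum>A\<in>F. u A) = 1"
  and u_deficit: "A \<in> F \<Longrightarrow> u A * (max_size - shadow_weight (card V) F A) = 0"
proof -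
  let ?s = "\<Sum>A\<in>F. u A * (max_size - shadow_weight (card V) F A)"
  have "?s \<ge> 0" using deficit_nonneg(1) by (rule sum_nonneg)
  then have "?s = 0" "max_size * (1 - (\<Sum>A\<in>F. u A)) = 0"
    using weighted_deficit deficit_nonneg(2) size by linarith+
  then show "(\<Sum>A\<in>F. u A) = 1" "A \<in> F \<Longrightarrow> u A * (max_size - shadow_weight (card V) F A) = 0"
    using max_size_pos sum_nonneg_eq_0_iff[OF fin_F deficit_nonneg(1)] by auto
qed

text \<open>A member that is topmost on some chain attains equality in the key estimate, and its window
  is a largest one.\<close>

lemma topmost_member:
  assumes A: "A \<in> F" "u A > 0"
  shows "2 * card A = card V + t \<or> 2 * card A + 1 = card V + t \<or> 2 * card A = card V + t + 1"
    and "card A < card V \<or> card A \<le> t \<Longrightarrow> Pow A \<inter> F = top_layers t A"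
proof -
  note sw = shadow_weight_le_window[OF member(2,3)[OF A(1)] temp[OF A(1)]]
  have eq: "shadow_weight (card V) F A = max_size" using u_deficit[OF A(1)] A(2) by simp
  then have w: "window (card V) t (card A) = max_size"
    using sw(1) window_le_central(1)[OF t_le member(3)[OF A(1)]] by simp
  then show "2 * card A = card V + t \<or> 2 * card A + 1 = card V + t \<or> 2 * card A = card V + t + 1"
    using window_le_central(2)[OF t_le member(3)[OF A(1)]] by simp
  show "Pow A \<inter> F = top_layers t A" if "card A < card V \<or> card A \<le> t"
    using sw(2)[OF that] eq w by simp
qed

text \<open>A maximal member containing \<open>A\<close> is topmost on every chain through it, so its size is central.\<close>

lemma card_member_le:
  assumes "A \<in> F"
  shows "2 * card A \<le> card V + t + 1"
proof -
  obtain C where C: "C \<in> F" "A \<subseteq> C" "\<And>D. D \<in> F \<Longrightarrow> C \<subseteq> D \<Longrightarrow> C = D"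
    using finite_has_maximal2[OF fin_F assms] by metis
  have "u C > 0" using C member(1) by (intro u_pos_if_no_member_above) auto
  then have "2 * card C \<le> card V + t + 1" using topmost_member(1)[OF C(1)] by linarith
  moreover have "card A \<le> card C" using C member(2) by (simp add: card_mono)
  ultimately show ?thesis by linarith
qed

text \<open>A chain that comes down to a non-member \<open>A\<close> unhindered would have its topmost member
  strictly below \<open>A\<close>, where the sizes are too small for a topmost member.\<close>

lemma reachable_low_set_is_member:
  assumes A: "A \<subseteq> V" "u A > 0" and low: "2 * card A \<le> card V + t"
  shows "A \<in> F"
proof (rule ccontr)
  assume "A \<notin> F"
  from topmost_member_below[OF fin sub sum_u A(1) this A(2)]
  obtain B where B: "B \<in> F" "B \<subset> A" "u B > 0" by blast
  have "card B < card A" using B A fin by (meson finite_subset psubset_card_mono)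
  then show False using topmost_member(1)[OF B(1,3)] low by linarith
qed

text \<open>Once \<open>F\<close> contains a whole layer and nothing above it, each set of this layer is topmost and
  determines \<open>F\<close> below itself; every smaller set lies below some set of the layer.\<close>

lemma eq_band:
  assumes le: "\<And>A. A \<in> F \<Longrightarrow> card A \<le> m" and all: "\<And>A. A \<subseteq> V \<Longrightarrow> card A = m \<Longrightarrow> A \<in> F"
    and m: "m < card V \<or> m = t"
  shows "F = band V (m - t) m"
proof -
  have mV: "m \<le> card V" using m t_le by auto
  have top: "Pow A \<inter> F = top_layers t A" if A: "A \<subseteq> V" "card A = m" for A
  proof -
    have "\<not> A \<subset> C" if "C \<in> F" for C
      using le[OF that] A psubset_card_mono[OF member(2)[OF that], of A] by auto
    then have "u A > 0" using A by (intro u_pos_if_no_member_above)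
    then show ?thesis using topmost_member(2)[OF all[OF A]] A m by auto
  qed
  have "B \<in> F \<longleftrightarrow> m - t \<le> card B" if B: "B \<subseteq> V" "card B \<le> m" for B
  proof -
    obtain A where A: "B \<subseteq> A" "A \<subseteq> V" "card A = m"
      using exists_subset_between[of B m V] B mV fin by blast
    then show ?thesis using top[of A] by (auto simp: top_layers_def)
  qed
  then show ?thesis using le member(1) by (auto simp: band_def)
qed

lemma eq_band_even:
  assumes m: "card V + t = 2 * m"
  shows "F = band V (m - t) m"
proof (rule eq_band)
  show le: "card A \<le> m" if "A \<in> F" for A using card_member_le[OF that] m by linarith
  show "A \<in> F" if A: "A \<subseteq> V" "card A = m" for A
  proof (rule reachable_low_set_is_member)
    have "\<not> A \<subset> C" if "C \<in> F" for C
      using le[OF that] A psubset_card_mono[OF member(2)[OF that], of A] by auto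
    then show "u A > 0" using A by (intro u_pos_if_no_member_above)
  qed (use A m in auto)
  show "m < card V \<or> m = t" using m t_le by linarith
qed

text \<open>When both layers \<open>m\<close> and \<open>m + 1\<close> can contain topmost members, \<open>F\<close> cannot mix them. Let \<open>C\<close> be
  the common \<open>m\<close>-subset of the neighbours \<open>A\<close> and \<open>A'\<close> in layer \<open>m + 1\<close>. If \<open>A\<close> is a member
  and \<open>A'\<close> is not, then \<open>C\<close> is topmost on a chain through \<open>A'\<close>, so \<open>F\<close> contains its subsets
  of size \<open>m - t\<close>. These are subsets of \<open>A\<close> below the top \<open>t + 1\<close> layers of \<open>A\<close>, a
  contradiction.\<close>

lemma swap_closed:
  assumes m: "card V + t = 2 * m + 1" "m + 1 < card V"
    and A: "A \<in> F" "card A = m + 1" and x: "x \<in> A" and y: "y \<in> V - A"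
  shows "insert y (A - {x}) \<in> F"
proof (rule ccontr)
  let ?C = "A - {x}" and ?A' = "insert y (A - {x})"
  assume out: "?A' \<notin> F"
  have C: "?C \<subseteq> V" "card ?C = m" "y \<in> V - ?C" and A': "?A' \<subseteq> V" "card ?A' = m + 1"
    using A x y member[OF A(1)] by auto
  have none: "\<not> S \<subset> D" if "D \<in> F" "card S = m + 1" for S D
    using card_member_le[OF that(1)] m that psubset_card_mono[OF member(2)[OF that(1)], of S] by auto
  have "u ?A' > 0" using A' none by (intro u_pos_if_no_member_above) auto
  then have uC: "u ?C > 0" using topmost_prob_pos_step[OF fin C(1,3)] out by blast
  then have "?C \<in> F" using reachable_low_set_is_member[OF C(1)] C(2) m by simp
  then have topC: "Pow ?C \<inter> F = top_layers t ?C" using topmost_member(2) uC C(2) m by simp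
  have "u A > 0" using member(1)[OF A(1)] A(2) none by (intro u_pos_if_no_member_above) auto
  then have topA: "Pow A \<inter> F = top_layers t A" using topmost_member(2) A m by simp
  have "t \<le> m" using m by linarith
  obtain D where D: "D \<subseteq> ?C" "card D = m - t"
    using obtain_subset_with_card_n[of "m - t" ?C] C(2) by auto
  then have "D \<in> top_layers t ?C" using C(2) by (auto simp: top_layers_def)
  then have "D \<in> top_layers t A" using topC topA D(1) by blast
  then show False using D(2) A(2) \<open>t \<le> m\<close> by (simp add: top_layers_def Suc_diff_le)
qed

end

text \<open>The Johnson graph is connected: exchanging one element at a time leads from any set to any
  other set of the same size.\<close>

lemma swap_connected:
  assumes V: "finite V" and A: "A \<in> F" "A \<subseteq> V" and A': "A' \<subseteq> V" "card A' = card A"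
    and swap: "\<And>B x y. B \<in> F \<Longrightarrow> B \<subseteq> V \<Longrightarrow> card B = card A' \<Longrightarrow> x \<in> B \<Longrightarrow> y \<in> V - B
      \<Longrightarrow> insert y (B - {x}) \<in> F"
  shows "A' \<in> F"
  using A A'(2)
proof (induction "card (A - A')" arbitrary: A)
  case 0
  then have "A \<subseteq> A'" using V finite_subset by fastforce
  then have "A = A'" using 0 A'(1) V by (metis card_subset_eq finite_subset)
  then show ?case using 0 by simp
next
  case (Suc d)
  have fA: "finite A" "finite A'" using V Suc.prems A'(1) finite_subset by blast+
  have "A - A' \<noteq> {}" using Suc.hyps(2) by (intro notI) simp
  then obtain x where x: "x \<in> A" "x \<notin> A'" by blast
  then have "\<not> A' \<subseteq> A" using fA Suc.prems(3) card_subset_eq by blast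
  then obtain y where y: "y \<in> A'" "y \<notin> A" by blast
  let ?B = "insert y (A - {x})"
  have "?B - A' = (A - A') - {x}" using y by auto
  then have d: "d = card (?B - A')" using Suc.hyps(2) x fA by simp
  have "card ?B = card A" using card_Suc_Diff1[OF fA(1) x(1)] y fA by simp
  moreover have "?B \<in> F" using swap[of A x y] Suc.prems x y A'(1) by auto
  ultimately show ?case using Suc.hyps(1)[OF d] Suc.prems x y A'(1) by auto
qed

context extremal_temperate_family
begin

text \<open>By connectivity, layer \<open>m + 1\<close> is either contained in \<open>F\<close> or disjoint from it. In the second
  case layer \<open>m\<close> takes its place.\<close>

lemma eq_band_odd:
  assumes m: "card V + t = 2 * m + 1" "m + 1 < card V"
  shows "F = band V (m - t) m \<or> F = band V (m + 1 - t) (m + 1)"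
proof (cases "\<exists>A\<in>F. card A = m + 1")
  case True
  then obtain A where A: "A \<in> F" "card A = m + 1" by blast
  have "F = band V (m + 1 - t) (m + 1)"
  proof (rule eq_band)
    show "card B \<le> m + 1" if "B \<in> F" for B using card_member_le[OF that] m by linarith
    show "B \<in> F" if B: "B \<subseteq> V" "card B = m + 1" for B
      using swap_connected[OF fin A(1) member(1)[OF A(1)] B(1)] swap_closed[OF m] A B by simp
  qed (use m in simp)
  then show ?thesis ..
next
  case False
  have le: "card B \<le> m" if "B \<in> F" for B
  proof -
    have "card B \<le> m + 1" "card B \<noteq> m + 1" using card_member_le[OF that] m that False by auto
    then show ?thesis by linarith
  qed
  have "F = band V (m - t) m"
  proof (rule eq_band[OF le])
    show "B \<in> F" if B: "B \<subseteq> V" "card B = m" for B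
    proof (rule reachable_low_set_is_member)
      have "\<not> B \<subset> C" if "C \<in> F" for C
        using le[OF that] B psubset_card_mono[OF member(2)[OF that], of B] by auto
      then show "u B > 0" using B by (intro u_pos_if_no_member_above)
    qed (use B m in auto)
  qed (use m in simp_all)
  then show ?thesis ..
qed

end

section \<open>Bands of consecutive layers and the classification\<close>

lemma card_band:
  assumes "finite V" "m \<le> card V"
  shows "card (band V (m - t) m) = window (card V) t m"
  using sum_over_subsets_by_card[OF assms, where a = "m - t" and g = "\<lambda>_. 1::nat"]
  by (simp add: band_def window_def)

text \<open>A set in the band has size at most \<open>m\<close>, so the band below it stays within its own top
  \<open>t + 1\<close> layers.\<close>

lemma card_shadow_band_le:
  assumes "finite A" "card A \<le> m"
  shows "card (Pow A \<inter> band V (m - t) m) \<le> (\<Sum>j=0..t. card A choose j)"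
  unfolding card_top_layers[OF assms(1), symmetric]
  using assms by (intro card_mono finite_top_layers) (auto simp: band_def top_layers_def)

lemma layers_eq_band: "layers n t s = band {1..n} s (s + t)"
proof -
  have "B \<in> layers n t s \<longleftrightarrow> B \<in> band {1..n} s (s + t)" for B
  proof (cases "B \<subseteq> {1..n}")
    case True
    then have "finite B" using finite_subset by blast
    then have "B \<in> layers n t s \<longleftrightarrow> (\<exists>j\<in>{0..t}. card B = s + j)"
      using True by (auto simp: layers_def nsets_def)
    also have "\<dots> \<longleftrightarrow> s \<le> card B \<and> card B \<le> s + t"
      by (auto intro!: bexI[of _ "card B - s"])
    finally show ?thesis using True by (simp add: band_def)
  qed (auto simp: layers_def nsets_def band_def)
  then show ?thesis by blast
qed

lemma temperate_familyI:
  assumes "t \<le> n" "family_on n F" "temperate t F"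
  shows "temperate_family {1..n} F t"
  using assms by unfold_locales (auto simp: family_on_def temperate_def mu_def)

lemma band_temperate:
  assumes "m \<le> n"
  shows "family_on n (band {1..n} (m - t) m)" "temperate t (band {1..n} (m - t) m)"
proof -
  show "family_on n (band {1..n} (m - t) m)" by (auto simp: family_on_def band_def)
  show "temperate t (band {1..n} (m - t) m)"
    unfolding temperate_def mu_def
    by (intro ballI card_shadow_band_le) (auto simp: band_def intro: finite_subset)
qed

lemma maximal_temperate_iff:
  assumes tn: "t \<le> n"
  shows "maximal_temperate t n F \<longleftrightarrow>
    family_on n F \<and> temperate t F \<and> card F = window n t ((n + t) div 2)" (is "_ \<longleftrightarrow> _ \<and> _ \<and> _ = ?M")
proof -
  let ?c = "(n + t) div 2"
  have c: "?c \<le> n" using tn by simp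
  have le: "card G \<le> ?M" if "family_on n G" "temperate t G" for G
    using temperate_family.card_le_max_size[OF temperate_familyI[OF tn that]] by simp
  \<comment> \<open>A central band of layers attains the upper bound.\<close>
  moreover have "card (band {1..n} (?c - t) ?c) = ?M" using card_band[of "{1..n}" ?c] c by simp
  ultimately show ?thesis
    unfolding maximal_temperate_def using band_temperate[OF c] by (metis le_antisym)
qed

lemma maximal_temperate_band:
  assumes "t \<le> n" "m \<le> n" "2 * m = n + t \<or> 2 * m + 1 = n + t \<or> 2 * m = n + t + 1"
  shows "maximal_temperate t n (band {1..n} (m - t) m)"
  using assms band_temperate[OF assms(2)] card_band[of "{1..n}" m t] window_le_central(2)[OF assms(1,2)]
  by (simp add: maximal_temperate_iff)

lemma extremal_temperate_familyI:
  assumes "t \<le> n" "maximal_temperate t n F"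
  shows "extremal_temperate_family {1..n} F t"
proof -
  interpret temperate_family "{1..n}" F t
    using assms by (intro temperate_familyI) (auto simp: maximal_temperate_def)
  show ?thesis using assms by unfold_locales (simp add: maximal_temperate_iff)
qed

lemma sum_choose_below: "(\<Sum>k=0..n. Suc n choose k) = 2 ^ Suc n - 1"
  using choose_row_sum[of "Suc n"] by (simp add: atLeast0AtMost)

text \<open>For \<open>n = t + 1\<close> the only obstruction is at the full ground set, where the bound is
  \<open>2 ^ n - 1\<close>: all smaller sets satisfy the condition because the bound counts all their
  subsets.\<close>

lemma maximal_temperate_all_but_one:
  assumes F: "family_on (Suc t) F" "card F = 2 ^ Suc t - 1"
  shows "maximal_temperate t (Suc t) F"
proof -
  have "window (Suc t) t ((Suc t + t) div 2) = card F"
    using sum_choose_below[of t] F by (simp add: window_def)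
  moreover have "temperate t F"
    unfolding temperate_def mu_def
  proof
    fix A assume A: "A \<in> F"
    then have "A \<subseteq> {1..Suc t}" using F by (auto simp: family_on_def)
    then have fA: "finite A" and cA: "card A \<le> Suc t"
      using finite_subset card_mono[of "{1..Suc t}" A] by auto
    have fF: "finite F" using F(1) unfolding family_on_def by (meson finite_Pow_iff finite_atLeastAtMost finite_subset)
    show "card (Pow A \<inter> F) \<le> (\<Sum>j=0..t. card A choose j)"
    proof (cases "card A = Suc t")
      case True
      have "card (Pow A \<inter> F) \<le> card F" using fF by (intro card_mono) auto
      then show ?thesis using True F sum_choose_below[of t] by simp
    next
      case False
      then have "top_layers t A = Pow A" using cA by (auto simp: top_layers_def)
      then show ?thesis using card_top_layers[OF fA, of t] fA
        by (metis card_mono finite_Pow_iff inf_le1)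
    qed
  qed
  ultimately show ?thesis using F by (simp add: maximal_temperate_iff)
qed

lemma cong_2_iff_even_diff:
  fixes t n :: nat
  assumes "t \<le> n"
  shows "[t = n] (mod 2) \<longleftrightarrow> even (n - t)"
proof -
  have "t mod 2 = n mod 2 \<longleftrightarrow> even (n + t)" by presburger
  then show ?thesis using assms by (simp add: cong_def)
qed

theorem theorem1p4:
  fixes t n :: nat
  assumes "t \<le> n"
  shows "([t = n] (mod 2) \<longrightarrow>
           {F. maximal_temperate t n F} = {layers n t ((n - t) div 2)}) \<and>
         (n \<ge> 1 \<and> t = n - 1 \<longrightarrow>
           (\<forall>F. family_on n F \<and> card F = 2 ^ n - 1 \<longrightarrow> maximal_temperate t n F)) \<and>
         (\<not> [t = n] (mod 2) \<and> t + 1 < n \<longrightarrow>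
           {F. maximal_temperate t n F} =
             {layers n t ((n - t - 1) div 2), layers n t ((n - t + 1) div 2)} \<and>
           layers n t ((n - t - 1) div 2) \<noteq> layers n t ((n - t + 1) div 2))"
proof (intro conjI impI allI)
  assume "[t = n] (mod 2)"
  then have "even (n - t)" using cong_2_iff_even_diff[OF assms] by simp
  then obtain s where s: "n - t = 2 * s" by blast
  define m where "m = s + t"
  have m: "m \<le> n" "n + t = 2 * m" "m - t = s" using s assms by (auto simp: m_def)
  have mid: "layers n t ((n - t) div 2) = band {1..n} (m - t) m"
    using s by (simp add: layers_eq_band m_def)
  have "F = band {1..n} (m - t) m" if "maximal_temperate t n F" for F
    using extremal_temperate_family.eq_band_even[OF extremal_temperate_familyI[OF assms that], of m] m
    by simp
  moreover have "maximal_temperate t n (band {1..n} (m - t) m)"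
    using m assms by (intro maximal_temperate_band) auto
  ultimately show "{F. maximal_temperate t n F} = {layers n t ((n - t) div 2)}"
    unfolding mid by blast
next
  fix F assume "n \<ge> 1 \<and> t = n - 1" and F: "family_on n F \<and> card F = 2 ^ n - 1"
  then have n: "n = Suc t" by simp
  show "maximal_temperate t n F" using F unfolding n by (blast intro: maximal_temperate_all_but_one)
next
  assume "\<not> [t = n] (mod 2) \<and> t + 1 < n"
  then have "odd (n - t)" and tn: "t + 1 < n"
    using cong_2_iff_even_diff[OF assms] by simp_all
  then obtain s where s: "n - t = 2 * s + 1" by (blast elim: oddE)
  define m where "m = s + t"
  have m: "m + 1 < n" "n + t = 2 * m + 1" "m - t = s" "m + 1 - t = s + 1"
    using s tn by (auto simp: m_def)
  have low: "layers n t ((n - t - 1) div 2) = band {1..n} (m - t) m"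
    using s by (simp add: layers_eq_band m_def)
  have high: "layers n t ((n - t + 1) div 2) = band {1..n} (m + 1 - t) (m + 1)"
    using s by (simp add: layers_eq_band m_def)
  have "F = band {1..n} (m - t) m \<or> F = band {1..n} (m + 1 - t) (m + 1)"
    if "maximal_temperate t n F" for F
    using extremal_temperate_family.eq_band_odd[OF extremal_temperate_familyI[OF assms that], of m] m
    by simp
  moreover have "maximal_temperate t n (band {1..n} (m - t) m)"
    "maximal_temperate t n (band {1..n} (m + 1 - t) (m + 1))"
    using m assms by (intro maximal_temperate_band; simp)+
  ultimately show "{F. maximal_temperate t n F} =
      {layers n t ((n - t - 1) div 2), layers n t ((n - t + 1) div 2)}"
    unfolding low high by blast
  have "{1..m + 1} \<in> band {1..n} (m + 1 - t) (m + 1)" "{1..m + 1} \<notin> band {1..n} (m - t) m"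
    using m by (auto simp: band_def)
  then show "layers n t ((n - t - 1) div 2) \<noteq> layers n t ((n - t + 1) div 2)"
    unfolding low high by metis
qed

end
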